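(* Let $X$ be a real normed space with dual $X^{\ast}$, let $T:X\rightrightarrows X^{\ast}$ be a multivalued operator, and let $(u,u^{\ast})\in \operatorname{gph}T$. Let $T^{\prime}:X\rightrightarrows X^{\ast}$ be the translation $T^{\prime}(x):=T(x+u)-u^{\ast}=\{x^{\ast}-u^{\ast}: x^{\ast}\in T(x+u)\}$, $x\in X$. Let $V=[\operatorname{dom}T^{\prime}]$ be the linear span of $\operatorname{dom}T^{\prime}$, and let $\hat{T}:V\rightrightarrows V^{\ast}$ be the reduction of $T^{\prime}$ on $V$, i.e. $\hat{T}(x)=\{x^{\ast}|_{V}: x^{\ast}\in T^{\prime}(x)\}$ for $x\in V$. Then $T$ is bimonotone if and only if there exists a single-valued, linear, skew symmetric operator $A:V\rightarrow V^{\ast}$ such that $\hat{T}(x)=\{Ax\}$ for all $x\in \operatorname{dom}T^{\prime}$.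
   Context: For a normed space $X$, $X^{\ast}$ denotes its (continuous) dual and $\langle x^{\ast},x\rangle$ the value of $x^{\ast}\in X^{\ast}$ at $x\in X$. A multivalued operator $T:X\rightrightarrows X^{\ast}$ assigns to each $x\in X$ a (possibly empty) subset $T(x)\subseteq X^{\ast}$; $\operatorname{dom}T=\{x\in X: T(x)\neq\emptyset\}$ and $\operatorname{gph}T=\{(x,x^{\ast}): x^{\ast}\in T(x)\}$. $T$ is called monotone if $\langle x^{\ast}-y^{\ast},x-y\rangle\geq 0$ for all $(x,x^{\ast}),(y,y^{\ast})\in\operatorname{gph}T$. $T$ is called bimonotone if both $T$ and $-T$ are monotone, i.e. $\langle x^{\ast}-y^{\ast},x-y\rangle=0$ for all $(x,x^{\ast}),(y,y^{\ast})\in\operatorname{gph}T$. $[S]$ denotes the linear span of a set $S\subseteq X$. A linear subspace $V\subseteq X$ (not necessarily closed) carries the norm inherited from $X$, and $V^{\ast}$ is its continuous dual. For $x^{\ast}\in X^{\ast}$, $x^{\ast}|_{V}\in V^{\ast}$ is its restriction to $V$. A linear operator $A:V\rightarrow V^{\ast}$ (defined on all of $V$, not assumed continuous) is called skew symmetric if $\langle Ax,y\rangle=-\langle Ay,x\rangle$ for all $x,y\in V$, equivalently $\langle Ax,x\rangle=0$ for all $x\in V$. *)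

theory Defs
  imports "HOL-Analysis.Analysis"
begin

type_synonym 'a operator = "'a \<Rightarrow> ('a \<Rightarrow>\<^sub>L real) set"

definition op_dom :: "'a::real_normed_vector operator \<Rightarrow> 'a set" where
  "op_dom T = {x. T x \<noteq> {}}"

definition gph :: "'a::real_normed_vector operator \<Rightarrow> ('a \<times> ('a \<Rightarrow>\<^sub>L real)) set" where
  "gph T = {(x, f). f \<in> T x}"

definition monotone_op :: "'a::real_normed_vector operator \<Rightarrow> bool" where
  "monotone_op T \<longleftrightarrow>
     (\<forall>(x, f) \<in> gph T. \<forall>(y, g) \<in> gph T. blinfun_apply (f - g) (x - y) \<ge> 0)"

definition neg_op :: "'a::real_normed_vector operator \<Rightarrow> 'a operator" where
  "neg_op T x = uminus ` T x"

definition bimonotone_op :: "'a::real_normed_vector operator \<Rightarrow> bool" where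
  "bimonotone_op T \<longleftrightarrow> monotone_op T \<and> monotone_op (neg_op T)"

definition translate_op ::
    "'a::real_normed_vector operator \<Rightarrow> 'a \<Rightarrow> ('a \<Rightarrow>\<^sub>L real) \<Rightarrow> 'a operator" where
  "translate_op T u f x = {g - f | g. g \<in> T (x + u)}"

text \<open>The continuous dual of a linear subspace \<open>V\<close>. Its elements
  are the functions on \<open>V\<close>, made unique by the value \<open>undefined\<close> outside \<open>V\<close>
  (\<open>extensional\<close>), which are linear on \<open>V\<close> and continuous for the norm inherited from the
  ambient space. They need not be given as restrictions of functionals on the whole space.\<close>

definition dual_on :: "'a::real_normed_vector set \<Rightarrow> ('a \<Rightarrow> real) set" where
  "dual_on V = {f \<in> extensional V.
     (\<forall>x\<in>V. \<forall>y\<in>V. f (x + y) = f x + f y) \<and>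
     (\<forall>c. \<forall>x\<in>V. f (c *\<^sub>R x) = c * f x) \<and>
     continuous_on V f}"

text \<open>The reduction is a multivalued operator on \<open>V\<close>; it is given the value \<open>{}\<close> outside \<open>V\<close>.\<close>

definition reduction ::
    "'a::real_normed_vector operator \<Rightarrow> 'a set \<Rightarrow> 'a \<Rightarrow> ('a \<Rightarrow> real) set" where
  "reduction T V x = (if x \<in> V then {restrict (blinfun_apply f) V | f. f \<in> T x} else {})"

text \<open>Linear maps from \<open>V\<close> to \<open>dual_on V\<close>, not required to be continuous. The right-hand sides
  are the vector space operations of \<open>dual_on V\<close>, i.e. the pointwise ones on \<open>V\<close>.\<close>

definition linear_to_dual :: "'a::real_normed_vector set \<Rightarrow> ('a \<Rightarrow> 'a \<Rightarrow> real) \<Rightarrow> bool" where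
  "linear_to_dual V A \<longleftrightarrow>
     A \<in> V \<rightarrow> dual_on V \<and>
     (\<forall>x\<in>V. \<forall>y\<in>V. A (x + y) = (\<lambda>v\<in>V. A x v + A y v)) \<and>
     (\<forall>c. \<forall>x\<in>V. A (c *\<^sub>R x) = (\<lambda>v\<in>V. c * A x v))"

definition skew_symmetric_on :: "'a::real_normed_vector set \<Rightarrow> ('a \<Rightarrow> 'a \<Rightarrow> real) \<Rightarrow> bool" where
  "skew_symmetric_on V A \<longleftrightarrow> (\<forall>x\<in>V. \<forall>y\<in>V. A x y = - A y x)"

end

theory Submission
  imports Defs
begin

text \<open>
  Bimonotonicity is invariant under translations of the graph, so \<open>T\<close> may be replaced by the
  translated operator, whose graph contains \<open>(0, 0)\<close>. Comparing a point of the graph with \<open>(0, 0)\<close>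
  gives \<open>\<langle>f, x\<rangle> = 0\<close>, and expanding \<open>\<langle>f - g, x - y\<rangle> = 0\<close> then leaves the cross relation
  \<open>\<langle>f, y\<rangle> = - \<langle>g, x\<rangle>\<close> for all \<open>(x, f)\<close> and \<open>(y, g)\<close> in the graph
  (\<open>bimonotone_cross\<close>).

  The cross relation turns a statement about the dependence of \<open>f\<close> on \<open>x\<close>, on which nothing is known
  a priori, into one about the dependence of \<open>\<langle>g, x\<rangle>\<close> on \<open>x\<close>, which is linear. Select one functional
  at each vector of a basis contained in the domain, and extend the selection to a linear map \<open>L\<close>.
  For fixed \<open>(y, g)\<close> the linear functionals \<open>x \<mapsto> \<langle>L x, y\<rangle>\<close> and \<open>x \<mapsto> - \<langle>g, x\<rangle>\<close> agree on the basis,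
  hence on the span \<open>V\<close> of the domain (\<open>bimonotone_linear_selection\<close>). This single identity shows
  that at a point \<open>x\<close> of the domain every value of the operator agrees with \<open>L x\<close> on the domain, hence
  on \<open>V\<close>, and that \<open>\<langle>L x, y\<rangle>\<close> is skew symmetric on \<open>V\<close>. So \<open>A x\<close> is the restriction of \<open>L x\<close> to \<open>V\<close>
  (\<open>bimonotone_imp_skew_linear\<close>).

  Conversely, only differences \<open>x - y\<close> of points of the domain enter the definition of
  bimonotonicity. They lie in \<open>V\<close>, so the functionals may be restricted to \<open>V\<close>, and
  \<open>\<langle>A x - A y, x - y\<rangle> = 0\<close> by skew symmetry (\<open>skew_reduction_imp_bimonotone\<close>).
\<close>

lemma bimonotone_op_iff:
  fixes T :: "'a::real_normed_vector operator"
  shows "bimonotone_op T \<longleftrightarrow> (\<forall>x y. \<forall>f\<in>T x. \<forall>g\<in>T y. blinfun_apply (f - g) (x - y) = 0)"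
proof -
  have mono: "monotone_op S \<longleftrightarrow> (\<forall>x y. \<forall>f\<in>S x. \<forall>g\<in>S y. blinfun_apply (f - g) (x - y) \<ge> 0)"
    for S :: "'a operator"
    unfolding monotone_op_def gph_def by blast
  have "monotone_op (neg_op T) \<longleftrightarrow>
      (\<forall>x y. \<forall>f\<in>T x. \<forall>g\<in>T y. blinfun_apply (f - g) (x - y) \<le> 0)"
    unfolding mono neg_op_def by (simp add: blinfun.bilinear_simps algebra_simps)
  with mono[of T] show ?thesis
    unfolding bimonotone_op_def by (metis order.eq_iff)
qed

lemma bimonotone_translate_op_iff:
  "bimonotone_op (translate_op T u f) \<longleftrightarrow> bimonotone_op T"
proof
  assume B: "bimonotone_op T"
  show "bimonotone_op (translate_op T u f)"
    unfolding bimonotone_op_iff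
  proof (intro allI ballI)
    fix x y g h assume "g \<in> translate_op T u f x" "h \<in> translate_op T u f y"
    then obtain g' h' where "g' \<in> T (x + u)" "h' \<in> T (y + u)" "g = g' - f" "h = h' - f"
      by (auto simp: translate_op_def)
    moreover from this B have "blinfun_apply (g' - h') ((x + u) - (y + u)) = 0"
      unfolding bimonotone_op_iff by blast
    ultimately show "blinfun_apply (g - h) (x - y) = 0" by simp
  qed
next
  assume B: "bimonotone_op (translate_op T u f)"
  show "bimonotone_op T"
    unfolding bimonotone_op_iff
  proof (intro allI ballI)
    fix x y g h assume "g \<in> T x" "h \<in> T y"
    then have "g - f \<in> translate_op T u f (x - u)" "h - f \<in> translate_op T u f (y - u)"
      by (auto simp: translate_op_def)
    with B have "blinfun_apply ((g - f) - (h - f)) ((x - u) - (y - u)) = 0"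
      unfolding bimonotone_op_iff by blast
    then show "blinfun_apply (g - h) (x - y) = 0" by simp
  qed
qed

lemma bimonotone_cross:
  assumes "bimonotone_op T" "0 \<in> T 0" "f \<in> T x" "g \<in> T y"
  shows "blinfun_apply f y = - blinfun_apply g x"
proof -
  have "blinfun_apply (f - g) (x - y) = 0"
       "blinfun_apply (f - 0) (x - 0) = 0" "blinfun_apply (g - 0) (y - 0) = 0"
    using assms unfolding bimonotone_op_iff by blast+
  then show ?thesis by (simp add: blinfun.bilinear_simps)
qed

lemma linear_blinfun_apply: "linear (blinfun_apply f)"
  by (rule bounded_linear.linear[OF blinfun.bounded_linear_right])

lemma linear_blinfun_apply_left:
  assumes "linear L"
  shows "linear (\<lambda>x. blinfun_apply (L x) y)"
  using linear_compose[OF assms bounded_linear.linear[OF blinfun.bounded_linear_left]]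
  by (simp add: o_def)

text \<open>The identity says that \<open>L\<close> is minus the transpose of every selection of the operator. It is
  what makes the choices behind \<open>L\<close> harmless: its right-hand side involves no choice.\<close>

lemma bimonotone_linear_selection:
  assumes "bimonotone_op T" "0 \<in> T 0"
  obtains L where "linear L"
    and "\<And>x y g. x \<in> span (op_dom T) \<Longrightarrow> g \<in> T y \<Longrightarrow> blinfun_apply (L x) y = - blinfun_apply g x"
proof -
  obtain B where B: "B \<subseteq> op_dom T" "independent B" "op_dom T \<subseteq> span B"
    using maximal_independent_subset by blast
  obtain L where L: "linear L" "\<forall>b\<in>B. L b = (SOME f. f \<in> T b)"
    using linear_independent_extend[OF B(2), of "\<lambda>b. SOME f. f \<in> T b"] by auto
  have sel: "L b \<in> T b" if "b \<in> B" for b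
    using that B(1) L(2) by (auto simp: op_dom_def some_in_eq)
  have "blinfun_apply (L x) y = - blinfun_apply g x"
    if x: "x \<in> span (op_dom T)" and g: "g \<in> T y" for x y g
  proof (rule linear_eq_on_span[of "\<lambda>x. blinfun_apply (L x) y" "\<lambda>x. - blinfun_apply g x" B])
    show "linear (\<lambda>x. blinfun_apply (L x) y)"
      using L(1) by (rule linear_blinfun_apply_left)
    show "linear (\<lambda>x. - blinfun_apply g x)"
      by (intro linear_compose_neg linear_blinfun_apply)
    show "blinfun_apply (L b) y = - blinfun_apply g b" if "b \<in> B" for b
      using bimonotone_cross[OF assms sel[OF that] g] .
    show "x \<in> span B"
      using x B(3) by (metis span_mono span_span subsetD)
  qed
  with L(1) show thesis by (rule that)
qed

lemma blinfun_eq_on_span: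
  fixes f g :: "'a::real_normed_vector \<Rightarrow>\<^sub>L real"
  assumes "\<And>y. y \<in> S \<Longrightarrow> blinfun_apply f y = blinfun_apply g y" "y \<in> span S"
  shows "blinfun_apply f y = blinfun_apply g y"
  using linear_blinfun_apply linear_blinfun_apply assms by (rule linear_eq_on_span)

lemma restrict_blinfun_in_dual_on:
  assumes "subspace V"
  shows "restrict (blinfun_apply f) V \<in> dual_on V"
proof -
  have "continuous_on V (restrict (blinfun_apply f) V) \<longleftrightarrow> continuous_on V (blinfun_apply f)"
    by (rule continuous_on_cong) auto
  moreover have "continuous_on V (blinfun_apply f)"
    by (intro continuous_intros)
  ultimately show ?thesis
    using assms unfolding dual_on_def
    by (auto simp: blinfun.bilinear_simps subspace_add subspace_scale)
qed

text \<open>Single-valuedness on \<open>V\<close> and skew symmetry both reduce to the domain, where the cross relation can be read in two ways: with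
  \<open>z\<close> in the domain and \<open>g\<close> a value at \<open>z\<close>, the number \<open>- \<langle>g, x\<rangle>\<close> equals \<open>\<langle>f, z\<rangle>\<close> for every value
  \<open>f\<close> at \<open>x\<close>, and it also equals \<open>\<langle>L x, z\<rangle>\<close> for every \<open>x\<close> in the span. Linearity in the second
  argument then replaces \<open>z\<close> by an arbitrary vector of the span. Single-valuedness comes first,
  because skew symmetry needs \<open>\<langle>g, x\<rangle> = \<langle>L z, x\<rangle>\<close>.\<close>

lemma bimonotone_imp_skew_linear:
  assumes T: "bimonotone_op T" "0 \<in> T 0"
  defines "V \<equiv> span (op_dom T)"
  shows "\<exists>A. linear_to_dual V A \<and> skew_symmetric_on V A \<and>
             (\<forall>x\<in>op_dom T. reduction T V x = {A x})"
proof -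
  obtain L where L: "linear L"
    and cross: "\<And>x y g. x \<in> V \<Longrightarrow> g \<in> T y \<Longrightarrow> blinfun_apply (L x) y = - blinfun_apply g x"
    using bimonotone_linear_selection[OF T] unfolding V_def by blast
  have V: "subspace V" "op_dom T \<subseteq> V"
    by (simp_all add: V_def span_superset)
  define A where "A x = restrict (blinfun_apply (L x)) V" for x
  have value_eq: "blinfun_apply f y = blinfun_apply (L x) y" if f: "f \<in> T x" and y: "y \<in> V" for x f y
  proof (rule blinfun_eq_on_span[of "op_dom T"])
    show "y \<in> span (op_dom T)" using y by (simp add: V_def)
    have x: "x \<in> V" using f V(2) by (auto simp: op_dom_def)
    fix z assume "z \<in> op_dom T"
    then obtain g where g: "g \<in> T z" by (auto simp: op_dom_def)
    show "blinfun_apply f z = blinfun_apply (L x) z"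
      using bimonotone_cross[OF T f g] cross[OF x g] by simp
  qed
  have skew: "blinfun_apply (L x) y = - blinfun_apply (L y) x" if x: "x \<in> V" and y: "y \<in> V" for x y
  proof (rule linear_eq_on_span[of "\<lambda>y. blinfun_apply (L x) y" "\<lambda>y. - blinfun_apply (L y) x" "op_dom T"])
    show "linear (blinfun_apply (L x))"
      by (rule linear_blinfun_apply)
    show "linear (\<lambda>y. - blinfun_apply (L y) x)"
      using linear_blinfun_apply_left[OF L] by (rule linear_compose_neg)
    show "y \<in> span (op_dom T)" using y by (simp add: V_def)
    fix z assume "z \<in> op_dom T"
    then obtain g where g: "g \<in> T z" by (auto simp: op_dom_def)
    show "blinfun_apply (L x) z = - blinfun_apply (L z) x"
      using cross[OF x g] value_eq[OF g x] by simp
  qed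
  have "linear_to_dual V A"
    unfolding linear_to_dual_def
  proof (intro conjI ballI allI)
    show "A \<in> V \<rightarrow> dual_on V"
      using restrict_blinfun_in_dual_on[OF V(1)] by (simp add: A_def)
    show "A (x + y) = (\<lambda>v\<in>V. A x v + A y v)" for x y
      by (rule ext) (simp add: A_def linear_add[OF L] blinfun.add_left)
    show "A (c *\<^sub>R x) = (\<lambda>v\<in>V. c * A x v)" for c x
      by (rule ext) (simp add: A_def linear_scale[OF L] blinfun.scaleR_left)
  qed
  moreover have "skew_symmetric_on V A"
    by (simp add: skew_symmetric_on_def A_def) (blast intro: skew)
  moreover have "reduction T V x = {A x}" if x: "x \<in> op_dom T" for x
  proof -
    have "x \<in> V" "T x \<noteq> {}" using x V(2) by (auto simp: op_dom_def)
    then have "reduction T V x = (\<lambda>f. restrict (blinfun_apply f) V) ` T x"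
      by (auto simp: reduction_def)
    also have "\<dots> = (\<lambda>f. A x) ` T x"
      unfolding A_def by (intro image_cong refl restrict_ext value_eq)
    also have "\<dots> = {A x}"
      using \<open>T x \<noteq> {}\<close> by (rule image_constant_conv[THEN trans, OF if_not_P])
    finally show ?thesis .
  qed
  ultimately show ?thesis by blast
qed

lemma skew_reduction_imp_bimonotone:
  assumes dom: "op_dom T \<subseteq> V" and skew: "skew_symmetric_on V A"
    and red: "\<And>x. x \<in> op_dom T \<Longrightarrow> reduction T V x = {A x}"
  shows "bimonotone_op T"
  unfolding bimonotone_op_iff
proof (intro allI ballI)
  fix x y f g assume f: "f \<in> T x" and g: "g \<in> T y"
  have eval: "x \<in> V \<and> (\<forall>v\<in>V. blinfun_apply f v = A x v)" if "f \<in> T x" for x f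
  proof -
    have x: "x \<in> op_dom T" "x \<in> V" using that dom by (auto simp: op_dom_def)
    then have "restrict (blinfun_apply f) V \<in> {A x}"
      using that unfolding red[OF x(1), symmetric] reduction_def by auto
    then have "A x = restrict (blinfun_apply f) V" by simp
    with x(2) show ?thesis by simp
  qed
  have "A x x = - A x x" "A y y = - A y y" "A x y = - A y x"
    using eval[OF f] eval[OF g] skew unfolding skew_symmetric_on_def by blast+
  then have "blinfun_apply f x = 0" "blinfun_apply g y = 0"
       "blinfun_apply f y = - blinfun_apply g x"
    using eval[OF f] eval[OF g] by simp_all
  then show "blinfun_apply (f - g) (x - y) = 0"
    by (simp add: blinfun.bilinear_simps)
qed

theorem theorem1:
  fixes T :: "'a::real_normed_vector operator"
    and u :: 'a and ustar :: "'a \<Rightarrow>\<^sub>L real"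
  assumes "(u, ustar) \<in> gph T"
  shows "let T' = translate_op T u ustar;
             V = span (op_dom T');
             That = reduction T' V
         in bimonotone_op T \<longleftrightarrow>
            (\<exists>A. linear_to_dual V A \<and> skew_symmetric_on V A \<and>
                 (\<forall>x\<in>op_dom T'. That x = {A x}))"
proof -
  define T' where "T' = translate_op T u ustar"
  have zero: "0 \<in> T' 0"
    using assms by (force simp: T'_def translate_op_def gph_def)
  have "bimonotone_op T' \<longleftrightarrow>
      (\<exists>A. linear_to_dual (span (op_dom T')) A \<and> skew_symmetric_on (span (op_dom T')) A \<and>
           (\<forall>x\<in>op_dom T'. reduction T' (span (op_dom T')) x = {A x}))"
    using bimonotone_imp_skew_linear[of T'] zero
      skew_reduction_imp_bimonotone[OF span_superset[of "op_dom T'"]]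
    by blast
  then show ?thesis
    by (simp add: Let_def T'_def bimonotone_translate_op_iff)
qed

end
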